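(* For any essential curve $\gamma\in\mathcal{C}(T)$ on the once-punctured torus $T$, there are finitely many elements in $T_\gamma$ that are not stable.
   Context: $T$ is a once-punctured topological torus. A curve is a free homotopy class of an unoriented closed curve on $T$; $\mathcal{C}(T)$ is the set of curves. $\pi_1(T)$ is free of rank $2$ on $\mathtt{a},\mathtt{b}$, $\mathtt{A}=\mathtt{a}^{-1}$, $\mathtt{B}=\mathtt{b}^{-1}$, and $\mathcal{C}(T)$ is in bijection with conjugacy classes of $\pi_1(T)$ up to inversion. A curve is essential if it is neither null-homotopic nor a power of a loop around the puncture (represented by the commutator of $\mathtt a$ and $\mathtt b$). The mapping classes $L,R\in\mathrm{Mod}(T)$ act on words by $L:\mathtt{a}\mapsto\mathtt{a},\mathtt{b}\mapsto\mathtt{ab}$ and $R:\mathtt{a}\mapsto\mathtt{ab},\mathtt{b}\mapsto\mathtt{b}$; $\langle L,R\rangle_+$ is the free monoid of positive products of $L$ and $R$ (including the identity). $T_\gamma:=\langle L,R\rangle_+\cdot\gamma$, seen as an infinite rooted binary tree: its vertices are indexed by the elements $M\in\langle L,R\rangle_+$, the vertex of $M$ being labelled by the curve $M\gamma$ and having as children the vertices of $LM$ and $RM$ (vertices with the same label are not identified). A word in $\{\mathtt{a},\mathtt{b},\mathtt{A},\mathtt{B}\}$ is monotone if it uses only letters of $\{\mathtt a,\mathtt b\}$ or only letters of $\{\mathtt A,\mathtt B\}$. Put $\mathtt{z}:=\mathtt{aBAb}$. A curve is stable if one of its representatives in $\pi_1(T)$ can be written as $\prod_{i=1}^n \mathtt{z}^{e_i}w_i$,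 with $n\ge1$, $e_i\in\mathbb{Z}$, all $e_i\neq0$ when $n>1$, and all $w_i$ non-empty monotone words. *)

theory Defs
  imports "HOL-Algebra.Group"
begin

section \<open>The fundamental group of the once-punctured torus\<close>

text \<open>
  The capitals denote the inverse letters.  The fundamental group is the free group on
  \<open>\<a>\<close>, \<open>\<b>\<close>, presented as words in the four letters modulo insertion and deletion of
  factors \<open>x x\<inverse>\<close>.
\<close>

datatype letter = \<a> | \<b> | \<A> | \<B>

type_synonym wd = "letter list"

fun inv_letter :: "letter \<Rightarrow> letter" where
  "inv_letter \<a> = \<A>"
| "inv_letter \<b> = \<B>"
| "inv_letter \<A> = \<a>"
| "inv_letter \<B> = \<b>"

inductive cancel :: "wd \<Rightarrow> wd \<Rightarrow> bool" where
  "cancel (u @ [x, inv_letter x] @ v) (u @ v)"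

definition free_eq :: "wd \<Rightarrow> wd \<Rightarrow> bool" where
  "free_eq = equivclp cancel"

quotient_type pi1 = wd / free_eq
  morphisms rep_pi1 elt
  by (simp add: free_eq_def)

lemma free_eq_refl [simp]: "free_eq u u"
  by (simp add: free_eq_def)

lemma free_eq_sym: "free_eq u v \<Longrightarrow> free_eq v u"
  unfolding free_eq_def by (rule equivclp_sym)

lemma free_eq_trans: "free_eq u v \<Longrightarrow> free_eq v w \<Longrightarrow> free_eq u w"
  unfolding free_eq_def by (rule equivclp_trans)

lemma free_eq_cancel: "free_eq (u @ [x, inv_letter x] @ v) (u @ v)"
  unfolding free_eq_def by (rule r_into_equivclp) (rule cancel.intros)

lemma free_eq_map:
  assumes "free_eq u v"
    and "\<And>p x q. free_eq (f (p @ [x, inv_letter x] @ q)) (f (p @ q))"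
  shows "free_eq (f u) (f v)"
  using assms(1) unfolding free_eq_def
proof (induction rule: equivclp_induct)
  case base
  then show ?case by simp
next
  case (step y z)
  have "free_eq (f y) (f z)"
    using step.hyps(2) assms(2) by (metis cancel.cases free_eq_sym)
  with step.IH show ?case
    by (metis free_eq_def free_eq_trans)
qed

lemma free_eq_append:
  assumes "free_eq u u'" and "free_eq v v'"
  shows "free_eq (u @ v) (u' @ v')"
proof -
  have "free_eq (u @ v) (u' @ v)"
    by (rule free_eq_map[OF assms(1), of "\<lambda>w. w @ v"]) (use free_eq_cancel in simp)
  moreover have "free_eq (u' @ v) (u' @ v')"
    by (rule free_eq_map[OF assms(2), of "\<lambda>w. u' @ w"])
      (metis append.assoc free_eq_cancel)
  ultimately show ?thesis by (rule free_eq_trans)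
qed

lemma inv_letter_inv_letter [simp]: "inv_letter (inv_letter x) = x"
  by (cases x) auto

definition inv_wd :: "wd \<Rightarrow> wd" where
  "inv_wd w = rev (map inv_letter w)"

lemma free_eq_inv_left: "free_eq (inv_wd w @ w) []"
proof (induction w)
  case Nil
  then show ?case by (simp add: inv_wd_def)
next
  case (Cons x w)
  have "free_eq (inv_wd w @ [inv_letter x, inv_letter (inv_letter x)] @ w) (inv_wd w @ w)"
    by (rule free_eq_cancel)
  with Cons show ?case
    by (auto simp: inv_wd_def intro: free_eq_trans)
qed

lift_definition mult_pi1 :: "pi1 \<Rightarrow> pi1 \<Rightarrow> pi1" is "(@)"
  by (rule free_eq_append)

definition F2 :: "pi1 monoid" where
  "F2 = \<lparr>carrier = UNIV, mult = mult_pi1, one = elt []\<rparr>"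

lemma carrier_F2 [simp]: "carrier F2 = UNIV"
  by (simp add: F2_def)

lemma one_F2: "\<one>\<^bsub>F2\<^esub> = elt []"
  by (simp add: F2_def)

lemma mult_F2: "elt u \<otimes>\<^bsub>F2\<^esub> elt v = elt (u @ v)"
  by (simp add: F2_def mult_pi1.abs_eq)

lemma elt_cases: obtains w where "g = elt w"
  by (metis Quotient_pi1 Quotient_abs_rep)

lemma group_F2: "group F2"
proof (rule groupI)
  fix x y z
  show "x \<otimes>\<^bsub>F2\<^esub> y \<otimes>\<^bsub>F2\<^esub> z = x \<otimes>\<^bsub>F2\<^esub> (y \<otimes>\<^bsub>F2\<^esub> z)"
    by (cases x rule: elt_cases; cases y rule: elt_cases; cases z rule: elt_cases)
      (simp add: mult_F2)
next
  fix x
  obtain w where w: "x = elt w" by (rule elt_cases)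
  show "\<one>\<^bsub>F2\<^esub> \<otimes>\<^bsub>F2\<^esub> x = x" by (simp add: w one_F2 mult_F2)
  have "elt (inv_wd w) \<otimes>\<^bsub>F2\<^esub> x = \<one>\<^bsub>F2\<^esub>"
    by (simp add: w mult_F2 one_F2 pi1.abs_eq_iff free_eq_inv_left)
  then show "\<exists>y\<in>carrier F2. y \<otimes>\<^bsub>F2\<^esub> x = \<one>\<^bsub>F2\<^esub>" by auto
qed simp_all

interpretation F2: group F2 by (rule group_F2)

lemma inv_F2: "inv\<^bsub>F2\<^esub> (elt w) = elt (inv_wd w)"
proof (rule F2.inv_equality)
  show "elt (inv_wd w) \<otimes>\<^bsub>F2\<^esub> elt w = \<one>\<^bsub>F2\<^esub>"
    by (simp add: mult_F2 one_F2 pi1.abs_eq_iff free_eq_inv_left)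
qed simp_all


section \<open>Curves\<close>

text \<open>
  Free homotopy classes of unoriented closed curves are identified with conjugacy classes of
  the fundamental group up to inversion.
\<close>

definition same_curve :: "pi1 \<Rightarrow> pi1 \<Rightarrow> bool" where
  "same_curve g g' \<longleftrightarrow>
     (\<exists>h. g' = h \<otimes>\<^bsub>F2\<^esub> g \<otimes>\<^bsub>F2\<^esub> inv\<^bsub>F2\<^esub> h \<or>
          g' = h \<otimes>\<^bsub>F2\<^esub> (inv\<^bsub>F2\<^esub> g) \<otimes>\<^bsub>F2\<^esub> inv\<^bsub>F2\<^esub> h)"

lemma same_curve_inv: "same_curve g g' \<longleftrightarrow> same_curve (inv\<^bsub>F2\<^esub> g) g'"
  by (auto simp: same_curve_def)

lemma conj_conj: "h \<otimes>\<^bsub>F2\<^esub> (k \<otimes>\<^bsub>F2\<^esub> g \<otimes>\<^bsub>F2\<^esub> inv\<^bsub>F2\<^esub> k) \<otimes>\<^bsub>F2\<^esub> inv\<^bsub>F2\<^esub> h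
    = (h \<otimes>\<^bsub>F2\<^esub> k) \<otimes>\<^bsub>F2\<^esub> g \<otimes>\<^bsub>F2\<^esub> inv\<^bsub>F2\<^esub> (h \<otimes>\<^bsub>F2\<^esub> k)"
  by (simp add: F2.inv_mult_group F2.m_assoc)

lemma inv_conj: "inv\<^bsub>F2\<^esub> (h \<otimes>\<^bsub>F2\<^esub> g \<otimes>\<^bsub>F2\<^esub> inv\<^bsub>F2\<^esub> h)
    = h \<otimes>\<^bsub>F2\<^esub> inv\<^bsub>F2\<^esub> g \<otimes>\<^bsub>F2\<^esub> inv\<^bsub>F2\<^esub> h"
  by (simp add: F2.inv_mult_group F2.m_assoc)

lemma equivp_same_curve: "equivp same_curve"
proof (rule equivpI)
  show "reflp same_curve"
    by (rule reflpI) (auto simp: same_curve_def intro!: exI[of _ "\<one>\<^bsub>F2\<^esub>"])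
  show "symp same_curve"
  proof (rule sympI)
    fix g g' assume "same_curve g g'"
    then obtain h k where k: "k = g \<or> k = inv\<^bsub>F2\<^esub> g"
      and g': "g' = h \<otimes>\<^bsub>F2\<^esub> k \<otimes>\<^bsub>F2\<^esub> inv\<^bsub>F2\<^esub> h"
      by (auto simp: same_curve_def)
    have "k = inv\<^bsub>F2\<^esub> h \<otimes>\<^bsub>F2\<^esub> g' \<otimes>\<^bsub>F2\<^esub> inv\<^bsub>F2\<^esub> (inv\<^bsub>F2\<^esub> h)"
      unfolding g' conj_conj by simp
    then have "same_curve g' k" unfolding same_curve_def by blast
    moreover have "inv\<^bsub>F2\<^esub> k =
        inv\<^bsub>F2\<^esub> h \<otimes>\<^bsub>F2\<^esub> inv\<^bsub>F2\<^esub> g' \<otimes>\<^bsub>F2\<^esub> inv\<^bsub>F2\<^esub> (inv\<^bsub>F2\<^esub> h)"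
      unfolding g' inv_conj conj_conj by simp
    then have "same_curve g' (inv\<^bsub>F2\<^esub> k)" unfolding same_curve_def by blast
    ultimately show "same_curve g' g" using k by auto
  qed
  show "transp same_curve"
    by (rule transpI) (unfold same_curve_def, metis conj_conj inv_conj F2.inv_inv carrier_F2 UNIV_I)
qed

quotient_type curve = pi1 / same_curve
  morphisms rep_curve curve_of
  by (rule equivp_same_curve)

definition commutator_ab :: pi1 where
  "commutator_ab = elt [\<a>, \<b>, \<A>, \<B>]"

text \<open>The exponent \<open>k = 0\<close> is the null-homotopic curve.\<close>

definition essential :: "curve \<Rightarrow> bool" where
  "essential \<gamma> \<longleftrightarrow>
     \<gamma> \<noteq> curve_of \<one>\<^bsub>F2\<^esub> \<and> (\<forall>k::int. \<gamma> \<noteq> curve_of (commutator_ab [^]\<^bsub>F2\<^esub> k))"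


section \<open>The mapping classes and the tree\<close>

datatype mcg_gen = \<L> | \<R>

fun subst_letter :: "mcg_gen \<Rightarrow> letter \<Rightarrow> wd" where
  "subst_letter \<L> \<a> = [\<a>]"
| "subst_letter \<L> \<b> = [\<a>, \<b>]"
| "subst_letter \<L> \<A> = [\<A>]"
| "subst_letter \<L> \<B> = [\<B>, \<A>]"
| "subst_letter \<R> \<a> = [\<a>, \<b>]"
| "subst_letter \<R> \<b> = [\<b>]"
| "subst_letter \<R> \<A> = [\<B>, \<A>]"
| "subst_letter \<R> \<B> = [\<B>]"

definition subst_wd :: "mcg_gen \<Rightarrow> wd \<Rightarrow> wd" where
  "subst_wd s w = concat (map (subst_letter s) w)"

lemma subst_letter_inv: "subst_letter s (inv_letter x) = inv_wd (subst_letter s x)"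
  by (cases s; cases x) (auto simp: inv_wd_def)

lemma inv_wd_inv_wd [simp]: "inv_wd (inv_wd w) = w"
  by (simp add: inv_wd_def rev_map comp_def)

lemma free_eq_inv_right: "free_eq (w @ inv_wd w) []"
  using free_eq_inv_left[of "inv_wd w"] by simp

lift_definition gen_pi1 :: "mcg_gen \<Rightarrow> pi1 \<Rightarrow> pi1" is subst_wd
proof (erule free_eq_map)
  fix s p x q
  show "free_eq (subst_wd s (p @ [x, inv_letter x] @ q)) (subst_wd s (p @ q))"
    using free_eq_append[OF free_eq_refl free_eq_append[OF free_eq_inv_right free_eq_refl]]
    by (simp add: subst_wd_def subst_letter_inv)
qed

lemma gen_pi1_hom: "gen_pi1 s \<in> hom F2 F2"
proof (rule homI)
  fix x y
  show "gen_pi1 s (x \<otimes>\<^bsub>F2\<^esub> y) = gen_pi1 s x \<otimes>\<^bsub>F2\<^esub> gen_pi1 s y"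
    by (cases x rule: elt_cases; cases y rule: elt_cases)
      (simp add: mult_F2 gen_pi1.abs_eq subst_wd_def)
qed simp

lemma group_hom_gen_pi1: "group_hom F2 F2 (gen_pi1 s)"
  by (simp add: group_hom_def group_hom_axioms_def group_F2 gen_pi1_hom)

lift_definition gen_curve :: "mcg_gen \<Rightarrow> curve \<Rightarrow> curve" is gen_pi1
proof -
  fix s g g' assume "same_curve g g'"
  interpret group_hom F2 F2 "gen_pi1 s" by (rule group_hom_gen_pi1)
  show "same_curve (gen_pi1 s g) (gen_pi1 s g')"
    using \<open>same_curve g g'\<close> unfolding same_curve_def by (auto simp del: F2.m_assoc)
qed

text \<open>
  Elements of the free monoid of positive products are words in the two generators, the word
  \<open>[s\<^sub>1, \<dots>, s\<^sub>k]\<close> being the composition \<open>s\<^sub>1 \<circ> \<dots> \<circ> s\<^sub>k\<close>.  The vertex \<open>M\<close> of the rooted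
  binary tree of \<open>\<gamma>\<close> carries the label \<open>tree_label \<gamma> M\<close> and has the children \<open>\<L> # M\<close> and
  \<open>\<R> # M\<close>.  By \<open>inj_pos_act\<close> below, distinct words are distinct mapping classes.
\<close>

definition pos_act :: "mcg_gen list \<Rightarrow> curve \<Rightarrow> curve" where
  "pos_act M \<gamma> = foldr gen_curve M \<gamma>"

definition tree_label :: "curve \<Rightarrow> mcg_gen list \<Rightarrow> curve" where
  "tree_label \<gamma> M = pos_act M \<gamma>"


section \<open>Stable curves\<close>

definition monotone_wd :: "wd \<Rightarrow> bool" where
  "monotone_wd w \<longleftrightarrow> set w \<subseteq> {\<a>, \<b>} \<or> set w \<subseteq> {\<A>, \<B>}"

definition z_elt :: pi1 where
  "z_elt = elt [\<a>, \<B>, \<A>, \<b>]"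

text \<open>The list \<open>[(e\<^sub>1, w\<^sub>1), \<dots>, (e\<^sub>n, w\<^sub>n)]\<close> stands for the product of the
  \<open>z_elt\<^bsup>e\<^esup> w\<close>, in order.\<close>

definition zprod :: "(int \<times> wd) list \<Rightarrow> pi1" where
  "zprod ps = foldr (\<otimes>\<^bsub>F2\<^esub>) (map (\<lambda>(e, w). z_elt [^]\<^bsub>F2\<^esub> e \<otimes>\<^bsub>F2\<^esub> elt w) ps) \<one>\<^bsub>F2\<^esub>"

definition stable :: "curve \<Rightarrow> bool" where
  "stable \<gamma> \<longleftrightarrow>
     (\<exists>ps. curve_of (zprod ps) = \<gamma> \<and>
           length ps \<ge> 1 \<and>
           (length ps > 1 \<longrightarrow> (\<forall>(e, w)\<in>set ps. e \<noteq> 0)) \<and>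
           (\<forall>(e, w)\<in>set ps. w \<noteq> [] \<and> monotone_wd w))"


section \<open>Faithfulness of the action of positive products\<close>

fun letter_exps :: "letter \<Rightarrow> int \<times> int" where
  "letter_exps \<a> = (1, 0)"
| "letter_exps \<b> = (0, 1)"
| "letter_exps \<A> = (-1, 0)"
| "letter_exps \<B> = (0, -1)"

definition exps :: "wd \<Rightarrow> int \<times> int" where
  "exps w = (\<Sum>x\<leftarrow>w. fst (letter_exps x), \<Sum>x\<leftarrow>w. snd (letter_exps x))"

lemma exps_append: "exps (u @ v) = (fst (exps u) + fst (exps v), snd (exps u) + snd (exps v))"
  by (simp add: exps_def)

lemma exps_inv_wd: "exps (inv_wd w) = (- fst (exps w), - snd (exps w))"
proof -
  have l: "letter_exps (inv_letter x) = (- fst (letter_exps x), - snd (letter_exps x))" for x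
    by (cases x) auto
  show ?thesis
    by (induction w) (auto simp: exps_def inv_wd_def l)
qed

lemma exps_free_eq: "free_eq u v \<Longrightarrow> exps u = exps v"
  unfolding free_eq_def
proof (induction rule: equivclp_induct)
  case base
  then show ?case by simp
next
  case (step y z)
  have "cancel p q \<Longrightarrow> exps p = exps q" for p q
  proof (erule cancel.cases)
    fix u x v assume "p = u @ [x, inv_letter x] @ v" "q = u @ v"
    then show "exps p = exps q" by (cases x) (auto simp: exps_def)
  qed
  with step show ?case by metis
qed

lemma exps_curve_of:
  assumes "curve_of (elt u) = curve_of (elt v)"
  shows "exps v = exps u \<or> exps v = (- fst (exps u), - snd (exps u))"
proof -
  obtain h where "elt v = h \<otimes>\<^bsub>F2\<^esub> elt u \<otimes>\<^bsub>F2\<^esub> inv\<^bsub>F2\<^esub> h \<or>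
      elt v = h \<otimes>\<^bsub>F2\<^esub> inv\<^bsub>F2\<^esub> (elt u) \<otimes>\<^bsub>F2\<^esub> inv\<^bsub>F2\<^esub> h"
    using assms by (auto simp: curve.abs_eq_iff same_curve_def)
  moreover obtain k where "h = elt k" by (rule elt_cases)
  ultimately have "free_eq v (k @ u @ inv_wd k) \<or> free_eq v (k @ inv_wd u @ inv_wd k)"
    by (auto simp: mult_F2 inv_F2 pi1.abs_eq_iff)
  then show ?thesis
    by (auto dest!: exps_free_eq simp: exps_append exps_inv_wd)
qed

lemma exps_subst:
  "exps (subst_wd \<L> w) = (fst (exps w) + snd (exps w), snd (exps w))"
  "exps (subst_wd \<R> w) = (fst (exps w), fst (exps w) + snd (exps w))"
proof -
  have "exps (subst_letter s x @ v) =
      (case s of \<L> \<Rightarrow> (fst (letter_exps x) + snd (letter_exps x) + fst (exps v),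
                        snd (letter_exps x) + snd (exps v))
       | \<R> \<Rightarrow> (fst (letter_exps x) + fst (exps v),
                  fst (letter_exps x) + snd (letter_exps x) + snd (exps v)))" for s x v
    by (cases s; cases x) (auto simp: exps_def)
  note * = this
  show "exps (subst_wd \<L> w) = (fst (exps w) + snd (exps w), snd (exps w))"
  proof (induction w)
    case (Cons x w)
    then show ?case using *[of \<L> x "subst_wd \<L> w"] by (auto simp: subst_wd_def exps_def)
  qed (simp add: subst_wd_def exps_def)
  show "exps (subst_wd \<R> w) = (fst (exps w), fst (exps w) + snd (exps w))"
  proof (induction w)
    case (Cons x w)
    then show ?case using *[of \<R> x "subst_wd \<R> w"] by (auto simp: subst_wd_def exps_def)
  qed (simp add: subst_wd_def exps_def)
qed

lemma pos_act_curve_of: "pos_act M (curve_of (elt w)) = curve_of (elt (foldr subst_wd M w))"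
  by (induction M) (simp_all add: pos_act_def gen_curve.abs_eq gen_pi1.abs_eq)

abbreviation ab_exps :: "mcg_gen list \<Rightarrow> int \<times> int" where
  "ab_exps M \<equiv> exps (foldr subst_wd M [\<a>, \<b>])"

lemma ab_exps_pos: "fst (ab_exps M) > 0 \<and> snd (ab_exps M) > 0"
proof (induction M)
  case Nil
  then show ?case by (simp add: exps_def)
next
  case (Cons s M)
  then show ?case by (cases s) (auto simp: exps_subst)
qed

lemma ab_exps_Nil: "ab_exps [] = (1, 1)"
  by (simp add: exps_def)

lemma ab_exps_inj: "ab_exps M = ab_exps N \<Longrightarrow> M = N"
proof (induction M arbitrary: N)
  case Nil
  show ?case
  proof (cases N)
    case (Cons s N')
    with Nil show ?thesis
      using ab_exps_pos[of N'] unfolding ab_exps_Nil by (cases s) (auto simp: exps_subst)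
  qed simp
next
  case (Cons s M)
  note IH = Cons.IH and eq = Cons.prems
  show ?case
  proof (cases N)
    case Nil
    with eq show ?thesis
      using ab_exps_pos[of M] unfolding Nil ab_exps_Nil by (cases s) (auto simp: exps_subst)
  next
    case (Cons t N')
    have "s = t \<and> ab_exps M = ab_exps N'"
      using eq ab_exps_pos[of M] ab_exps_pos[of N']
      by (cases s; cases t) (auto simp: Cons exps_subst prod_eq_iff)
    with Cons IH show ?thesis by auto
  qed
qed

lemma inj_pos_act: "inj pos_act"
proof (rule injI)
  fix M N assume "pos_act M = pos_act N"
  then have "pos_act M (curve_of (elt [\<a>, \<b>])) = pos_act N (curve_of (elt [\<a>, \<b>]))"
    by simp
  then have "curve_of (elt (foldr subst_wd M [\<a>, \<b>])) = curve_of (elt (foldr subst_wd N [\<a>, \<b>]))"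
    by (simp add: pos_act_curve_of)
  from exps_curve_of[OF this] have "ab_exps M = ab_exps N"
    using ab_exps_pos[of M] ab_exps_pos[of N] by auto
  then show "M = N" by (rule ab_exps_inj)
qed

end

theory Submission
  imports Defs "HOL-Library.Multiset"
begin

text \<open>
  Both generators fix \<open>z\<close> and preserve monotonicity, so stability is inherited by descendants.
  Write a curve as a cyclic product of factors \<open>z\<^sup>e w\<close> with \<open>w\<close> monotone, possibly \<open>e = 0\<close> or
  \<open>w\<close> empty.  If it is neither stable nor a power of \<open>z\<close>, some \<open>w\<close> is empty, and two factors
  merge, or some \<open>e\<close> vanishes.  In the latter case two monotone words meet, say a positive and a
  negative one, and, after cancellation, \<open>\<L>\<close> turns the sign change \<open>\<a>\<B>\<close> or \<open>\<b>\<A>\<close> into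
  \<open>\<a>\<B>\<A> = z\<B>\<close> or \<open>\<a>\<b>\<A> = \<b>z\<inverse>\<close>.  So \<open>\<L>\<close> lowers the pair (number of factors, number of vanishing
  exponents) lexicographically, and by induction every vertex of the form \<open>\<L>\<R>\<^sup>j\<close> has finitely
  many unstable descendants.  It remains to see that \<open>\<R>\<^sup>N\<close> yields a stable curve for some \<open>N\<close>.
  Now \<open>\<R>\<close> preserves the total number of letters \<open>\<a>\<close>, \<open>\<A>\<close>, whereas iterating \<open>\<R>\<close> either makes one
  side of the sign change cancel or allows a substitution \<open>\<a>\<B>\<^sup>k\<A> = (z\<B>)\<^sup>k\<close> or
  \<open>\<a>\<b>\<^sup>k\<A> = (\<b>z\<inverse>)\<^sup>k\<close>, which consumes two of these letters; this number, followed by the pair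
  above, is the decreasing quantity.  Changes from negative to positive are symmetric, with \<open>\<L>\<close>
  and \<open>\<R>\<close> exchanged.
\<close>

section \<open>Conjugacy and peripheral curves\<close>

lemma elt_append: "elt (u @ v) = elt u \<otimes>\<^bsub>F2\<^esub> elt v"
  by (simp add: mult_F2)

lemma elt_cancel: "elt (u @ x # inv_letter x # v) = elt (u @ v)"
  using free_eq_cancel[of u x v] by (simp add: pi1.abs_eq_iff)

lemma elt_cancel': "elt (u @ inv_letter x # x # v) = elt (u @ v)"
  using elt_cancel[of u "inv_letter x" v] by simp

lemma same_curve_hom:
  assumes "group_hom F2 F2 f" and "same_curve g h"
  shows "same_curve (f g) (f h)"
proof -
  interpret group_hom F2 F2 f by fact
  show ?thesis
    using assms(2) unfolding same_curve_def by (auto simp del: F2.m_assoc)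
qed

text \<open>Conjugation by the inverse of \<open>g\<close> moves \<open>g\<close> to the end. This
  is what allows products to be rotated cyclically.\<close>

lemma curve_of_commute: "curve_of (g \<otimes>\<^bsub>F2\<^esub> h) = curve_of (h \<otimes>\<^bsub>F2\<^esub> g)"
proof -
  have "h \<otimes>\<^bsub>F2\<^esub> g = inv\<^bsub>F2\<^esub> g \<otimes>\<^bsub>F2\<^esub> (g \<otimes>\<^bsub>F2\<^esub> h) \<otimes>\<^bsub>F2\<^esub> inv\<^bsub>F2\<^esub> (inv\<^bsub>F2\<^esub> g)"
    by (simp add: F2.m_assoc[symmetric])
  then show ?thesis
    unfolding curve.abs_eq_iff same_curve_def by blast
qed

lemma inv_z_elt: "inv\<^bsub>F2\<^esub> z_elt = elt [\<B>, \<a>, \<b>, \<A>]"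
  by (simp add: z_elt_def inv_F2 inv_wd_def)

lemma inv_mult_cancel: "inv\<^bsub>F2\<^esub> h \<otimes>\<^bsub>F2\<^esub> (h \<otimes>\<^bsub>F2\<^esub> g) = g"
  by (simp flip: F2.m_assoc)

lemma conj_int_pow:
  "(h \<otimes>\<^bsub>F2\<^esub> g \<otimes>\<^bsub>F2\<^esub> inv\<^bsub>F2\<^esub> h) [^]\<^bsub>F2\<^esub> (k::int) = h \<otimes>\<^bsub>F2\<^esub> g [^]\<^bsub>F2\<^esub> k \<otimes>\<^bsub>F2\<^esub> inv\<^bsub>F2\<^esub> h"
proof -
  have "(\<lambda>g. h \<otimes>\<^bsub>F2\<^esub> g \<otimes>\<^bsub>F2\<^esub> inv\<^bsub>F2\<^esub> h) \<in> hom F2 F2"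
    by (rule homI) (simp_all add: F2.m_assoc inv_mult_cancel)
  then interpret group_hom F2 F2 "\<lambda>g. h \<otimes>\<^bsub>F2\<^esub> g \<otimes>\<^bsub>F2\<^esub> inv\<^bsub>F2\<^esub> h"
    by (simp add: group_hom_def group_hom_axioms_def group_F2)
  show ?thesis
    using hom_int_pow[of g k] by simp
qed

text \<open>The inverse of the commutator is \<open>\<b>\<a>\<B>\<A>\<close>, the conjugate of
  \<open>z_elt\<close> by \<open>\<b>\<close>.\<close>

lemma curve_of_commutator_pow:
  "curve_of (commutator_ab [^]\<^bsub>F2\<^esub> (k::int)) = curve_of (z_elt [^]\<^bsub>F2\<^esub> (- k))"
proof -
  have c: "inv\<^bsub>F2\<^esub> commutator_ab = elt [\<b>] \<otimes>\<^bsub>F2\<^esub> z_elt \<otimes>\<^bsub>F2\<^esub> inv\<^bsub>F2\<^esub> (elt [\<b>])"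
    using elt_cancel[of "[\<b>, \<a>, \<B>, \<A>]" \<b> "[]"]
    by (simp add: commutator_ab_def z_elt_def inv_F2 mult_F2 inv_wd_def)
  have "commutator_ab [^]\<^bsub>F2\<^esub> k = (inv\<^bsub>F2\<^esub> commutator_ab) [^]\<^bsub>F2\<^esub> (- k)"
    by (simp add: F2.int_pow_inv F2.int_pow_neg)
  also have "\<dots> = elt [\<b>] \<otimes>\<^bsub>F2\<^esub> z_elt [^]\<^bsub>F2\<^esub> (- k) \<otimes>\<^bsub>F2\<^esub> inv\<^bsub>F2\<^esub> (elt [\<b>])"
    unfolding c by (rule conj_int_pow)
  finally have "curve_of (z_elt [^]\<^bsub>F2\<^esub> (- k)) = curve_of (commutator_ab [^]\<^bsub>F2\<^esub> k)"
    unfolding curve.abs_eq_iff same_curve_def by blast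
  then show ?thesis by simp
qed

text \<open>The null-homotopic curve is the case \<open>k = 0\<close>.\<close>

lemma essential_iff: "essential \<gamma> \<longleftrightarrow> (\<forall>k::int. \<gamma> \<noteq> curve_of (z_elt [^]\<^bsub>F2\<^esub> k))"
proof
  assume "essential \<gamma>"
  then have "\<gamma> \<noteq> curve_of (z_elt [^]\<^bsub>F2\<^esub> (- (- k)))" for k :: int
    by (simp only: essential_def flip: curve_of_commutator_pow) blast
  then show "\<forall>k::int. \<gamma> \<noteq> curve_of (z_elt [^]\<^bsub>F2\<^esub> k)" by simp
next
  assume nz: "\<forall>k::int. \<gamma> \<noteq> curve_of (z_elt [^]\<^bsub>F2\<^esub> k)"
  with nz[rule_format, of 0] show "essential \<gamma>"
    by (simp add: essential_def curve_of_commutator_pow)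
qed


section \<open>The generators are injective and fix \<open>z\<close>\<close>

lemma subst_wd_append: "subst_wd s (u @ v) = subst_wd s u @ subst_wd s v"
  by (simp add: subst_wd_def)

lemma subst_wd_Nil [simp]: "subst_wd s [] = []"
  by (simp add: subst_wd_def)

lemma subst_wd_Cons: "subst_wd s (x # v) = subst_letter s x @ subst_wd s v"
  by (simp add: subst_wd_def)

lemma gen_pi1_elt: "gen_pi1 s (elt w) = elt (subst_wd s w)"
  by (simp add: gen_pi1.abs_eq)

section \<open>The inverses of the two generators\<close>

fun unsubst_letter :: "mcg_gen \<Rightarrow> letter \<Rightarrow> wd" where
  "unsubst_letter \<L> \<a> = [\<a>]"
| "unsubst_letter \<L> \<b> = [\<A>, \<b>]"
| "unsubst_letter \<L> \<A> = [\<A>]"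
| "unsubst_letter \<L> \<B> = [\<B>, \<a>]"
| "unsubst_letter \<R> \<a> = [\<a>, \<B>]"
| "unsubst_letter \<R> \<b> = [\<b>]"
| "unsubst_letter \<R> \<A> = [\<b>, \<A>]"
| "unsubst_letter \<R> \<B> = [\<B>]"

definition unsubst_wd :: "mcg_gen \<Rightarrow> wd \<Rightarrow> wd" where
  "unsubst_wd s w = concat (map (unsubst_letter s) w)"

lemma unsubst_letter_inv: "unsubst_letter s (inv_letter x) = inv_wd (unsubst_letter s x)"
  by (cases s; cases x) (auto simp: inv_wd_def)

lift_definition ungen_pi1 :: "mcg_gen \<Rightarrow> pi1 \<Rightarrow> pi1" is unsubst_wd
proof (erule free_eq_map)
  fix s p x q
  show "free_eq (unsubst_wd s (p @ [x, inv_letter x] @ q)) (unsubst_wd s (p @ q))"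
    using free_eq_append[OF free_eq_refl free_eq_append[OF free_eq_inv_right free_eq_refl]]
    by (simp add: unsubst_wd_def unsubst_letter_inv)
qed

lemma group_hom_ungen_pi1: "group_hom F2 F2 (ungen_pi1 s)"
proof -
  have "ungen_pi1 s \<in> hom F2 F2"
  proof (rule homI)
    fix x y
    show "ungen_pi1 s (x \<otimes>\<^bsub>F2\<^esub> y) = ungen_pi1 s x \<otimes>\<^bsub>F2\<^esub> ungen_pi1 s y"
      by (cases x rule: elt_cases; cases y rule: elt_cases)
        (simp add: mult_F2 ungen_pi1.abs_eq unsubst_wd_def)
  qed simp
  then show ?thesis by (simp add: group_hom_def group_hom_axioms_def group_F2)
qed

lemma ungen_gen_pi1: "ungen_pi1 s (gen_pi1 s g) = g"
proof (cases g rule: elt_cases)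
  case (1 w)
  have l: "free_eq (unsubst_wd s (subst_letter s x)) [x]" for x
    using free_eq_cancel[of "[]" \<a> "[\<b>]"] free_eq_cancel[of "[\<a>]" \<B> "[]"]
      free_eq_cancel[of "[\<B>]" \<a> "[]"] free_eq_cancel[of "[]" \<B> "[\<A>]"]
    by (cases s; cases x) (simp_all add: unsubst_wd_def)
  have "free_eq (unsubst_wd s (subst_wd s w)) w"
  proof (induction w)
    case (Cons x w)
    with free_eq_append[OF l Cons] show ?case by (simp add: subst_wd_def unsubst_wd_def)
  qed (simp add: subst_wd_def unsubst_wd_def)
  then show ?thesis
    by (simp add: 1 gen_pi1_elt ungen_pi1.abs_eq pi1.abs_eq_iff)
qed

text \<open>\<open>\<L>\<close> turns \<open>\<a>\<B>\<A>\<b>\<close> into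
  \<open>\<a>\<B>\<A>\<A>\<a>\<b>\<close>, and \<open>\<R>\<close> turns it into
  \<open>\<a>\<b>\<B>\<B>\<A>\<b>\<close>. One cancellation restores it in either case.\<close>

lemma gen_z_elt: "gen_pi1 s z_elt = z_elt"
  using elt_cancel[of "[\<a>, \<B>, \<A>]" \<A> "[\<b>]"] elt_cancel[of "[\<a>]" \<b> "[\<B>, \<A>, \<b>]"]
  by (cases s) (simp_all add: z_elt_def gen_pi1_elt subst_wd_def)

lemma gen_z_pow: "gen_pi1 s (z_elt [^]\<^bsub>F2\<^esub> (k::int)) = z_elt [^]\<^bsub>F2\<^esub> k"
proof -
  interpret group_hom F2 F2 "gen_pi1 s" by (rule group_hom_gen_pi1)
  show ?thesis by (simp add: hom_int_pow gen_z_elt)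
qed

text \<open>The left inverse \<open>ungen_pi1\<close> fixes the powers of \<open>z_elt\<close> as
  well, so if the image is such a power, the original curve already was one.\<close>

lemma essential_gen_curve:
  assumes "essential \<gamma>"
  shows "essential (gen_curve s \<gamma>)"
  unfolding essential_iff
proof (intro allI notI)
  fix k :: int assume eq: "gen_curve s \<gamma> = curve_of (z_elt [^]\<^bsub>F2\<^esub> k)"
  obtain g where g: "\<gamma> = curve_of g" by (metis Quotient_curve Quotient_abs_rep)
  have "same_curve (gen_pi1 s g) (gen_pi1 s (z_elt [^]\<^bsub>F2\<^esub> k))"
    using eq by (simp add: g gen_curve.abs_eq curve.abs_eq_iff gen_z_pow)
  then have "same_curve g (z_elt [^]\<^bsub>F2\<^esub> k)"
    using same_curve_hom[OF group_hom_ungen_pi1] ungen_gen_pi1 by metis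
  then show False using assms by (simp add: g essential_iff curve.abs_eq_iff)
qed

lemma essential_gen_curve_pow: "essential \<gamma> \<Longrightarrow> essential ((gen_curve s ^^ n) \<gamma>)"
  by (induction n) (simp_all add: essential_gen_curve)


section \<open>Products of powers of \<open>z\<close> and monotone words\<close>

lemma zprod_Nil: "zprod [] = \<one>\<^bsub>F2\<^esub>"
  by (simp add: zprod_def)

lemma zprod_Cons: "zprod ((e, w) # ps) = z_elt [^]\<^bsub>F2\<^esub> e \<otimes>\<^bsub>F2\<^esub> (elt w \<otimes>\<^bsub>F2\<^esub> zprod ps)"
  by (simp add: zprod_def F2.m_assoc)

lemma zprod_append: "zprod (ps @ qs) = zprod ps \<otimes>\<^bsub>F2\<^esub> zprod qs"
  by (induction ps) (auto simp: zprod_Nil zprod_Cons F2.m_assoc)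

lemma zprod_Cons_0: "zprod ((0, w) # ps) = elt w \<otimes>\<^bsub>F2\<^esub> zprod ps"
  by (simp add: zprod_Cons)

text \<open>Supplies the initial form of an arbitrary element: each letter is a monotone word of its
  own, and all exponents vanish.\<close>

lemma zprod_letters: "zprod (map (\<lambda>x. (0, [x])) w) = elt w"
proof (induction w)
  case (Cons x w)
  then show ?case using elt_append[of "[x]" w] by (simp add: zprod_Cons_0)
qed (simp add: zprod_Nil one_F2)

definition map_words :: "(wd \<Rightarrow> wd) \<Rightarrow> (int \<times> wd) list \<Rightarrow> (int \<times> wd) list" where
  "map_words f = map (map_prod id f)"

lemma map_words_simps [simp]:
  "map_words f [] = []"
  "map_words f ((e, w) # ps) = (e, f w) # map_words f ps"
  "length (map_words f ps) = length ps"
  by (simp_all add: map_words_def)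

lemma ball_map_words:
  "(\<forall>(e, w)\<in>set (map_words f ps). Q e w) \<longleftrightarrow> (\<forall>(e, w)\<in>set ps. Q e (f w))"
  by (auto simp: map_words_def)

lemma gen_zprod: "gen_pi1 s (zprod ps) = zprod (map_words (subst_wd s) ps)"
proof (induction ps)
  case Nil
  interpret group_hom F2 F2 "gen_pi1 s" by (rule group_hom_gen_pi1)
  show ?case by (simp add: zprod_Nil)
next
  case (Cons p ps)
  interpret group_hom F2 F2 "gen_pi1 s" by (rule group_hom_gen_pi1)
  from Cons show ?case by (cases p) (simp add: zprod_Cons gen_z_pow gen_pi1_elt)
qed

lemma gen_curve_pow_zprod:
  "(gen_curve s ^^ n) (curve_of (zprod ps)) = curve_of (zprod (map_words (subst_wd s ^^ n) ps))"
proof (induction n)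
  case 0
  then show ?case by (simp add: map_words_def prod.map_id0[unfolded id_def] id_def)
next
  case (Suc n)
  then show ?case
    by (simp add: gen_curve.abs_eq gen_zprod)
      (simp add: map_words_def prod.map_comp comp_def id_def)
qed

text \<open>Weaker than what \<open>stable\<close> demands: vanishing exponents and empty words are
  allowed, so every curve has such a form.\<close>

definition monotone_form :: "(int \<times> wd) list \<Rightarrow> bool" where
  "monotone_form ps \<longleftrightarrow> (\<forall>(e, w)\<in>set ps. monotone_wd w)"

lemma monotone_form_simps [simp]:
  "monotone_form []"
  "monotone_form ((e, w) # ps) \<longleftrightarrow> monotone_wd w \<and> monotone_form ps"
  "monotone_form (ps @ qs) \<longleftrightarrow> monotone_form ps \<and> monotone_form qs"
  by (auto simp: monotone_form_def)

lemma set_subst_wd: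
  "set w \<subseteq> {\<a>, \<b>} \<Longrightarrow> set (subst_wd s w) \<subseteq> {\<a>, \<b>}"
  "set w \<subseteq> {\<A>, \<B>} \<Longrightarrow> set (subst_wd s w) \<subseteq> {\<A>, \<B>}"
  by (induction w; cases s; auto simp: subst_wd_Cons)+

lemma set_subst_wd_pow:
  "set w \<subseteq> {\<a>, \<b>} \<Longrightarrow> set ((subst_wd s ^^ n) w) \<subseteq> {\<a>, \<b>}"
  "set w \<subseteq> {\<A>, \<B>} \<Longrightarrow> set ((subst_wd s ^^ n) w) \<subseteq> {\<A>, \<B>}"
  by (induction n) (simp_all add: set_subst_wd)

lemma monotone_subst_wd_pow: "monotone_wd w \<Longrightarrow> monotone_wd ((subst_wd s ^^ n) w)"
  using set_subst_wd_pow unfolding monotone_wd_def by blast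

lemma monotone_subst_wd: "monotone_wd w \<Longrightarrow> monotone_wd (subst_wd s w)"
  using set_subst_wd unfolding monotone_wd_def by blast

lemma monotone_form_subst:
  "monotone_form ps \<Longrightarrow> monotone_form (map_words (subst_wd s ^^ n) ps)"
  by (auto simp: monotone_form_def map_words_def monotone_subst_wd_pow)

lemma subst_wd_eq_Nil_iff: "subst_wd s w = [] \<longleftrightarrow> w = []"
proof (cases w)
  case (Cons x v)
  then show ?thesis by (cases s; cases x) (auto simp: subst_wd_Cons)
qed simp

text \<open>The exponents stay as they are, and the words remain monotone and non-empty, so the
  image of a stable form is a stable form.\<close>

lemma stable_gen_curve:
  assumes "stable \<gamma>"
  shows "stable (gen_curve s \<gamma>)"
proof -
  obtain ps where ps: "curve_of (zprod ps) = \<gamma>" "length ps \<ge> 1"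
    "length ps > 1 \<longrightarrow> (\<forall>(e, w)\<in>set ps. e \<noteq> 0)" "\<forall>(e, w)\<in>set ps. w \<noteq> [] \<and> monotone_wd w"
    using assms unfolding stable_def by blast
  have "curve_of (zprod (map_words (subst_wd s) ps)) = gen_curve s \<gamma>"
    using ps(1) by (auto simp: gen_curve.abs_eq gen_zprod)
  moreover have "\<forall>(e, w)\<in>set (map_words (subst_wd s) ps). w \<noteq> [] \<and> monotone_wd w"
    using ps(4) monotone_subst_wd unfolding ball_map_words subst_wd_eq_Nil_iff by fast
  moreover have "length ps > 1 \<longrightarrow> (\<forall>(e, w)\<in>set (map_words (subst_wd s) ps). e \<noteq> 0)"
    using ps(3) unfolding ball_map_words by fast
  ultimately show ?thesis
    using ps(2) unfolding stable_def
    by (intro exI[of _ "map_words (subst_wd s) ps"]) (simp only: map_words_simps simp_thms)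
qed

lemma stable_pos_act: "stable \<gamma> \<Longrightarrow> stable (pos_act M \<gamma>)"
  by (induction M) (simp_all add: pos_act_def stable_gen_curve)


lemma curve_of_rotate: "curve_of (zprod (ps @ qs)) = curve_of (zprod (qs @ ps))"
  by (simp add: zprod_append curve_of_commute)


section \<open>Resolving a sign change\<close>

text \<open>Counts \<open>\<a>\<close>, \<open>\<A>\<close> for \<open>s = \<R>\<close> and
  \<open>\<b>\<close>, \<open>\<B>\<close> for \<open>s = \<L>\<close>. To each of these letters the
  generator attaches one letter that it fixes, so the count is invariant although the words
  grow.\<close>

definition moved :: "mcg_gen \<Rightarrow> wd \<Rightarrow> nat" where
  "moved s w = length (filter (\<lambda>x. subst_letter s x \<noteq> [x]) w)"

lemma moved_simps [simp]:
  "moved s [] = 0"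
  "moved s (u @ v) = moved s u + moved s v"
  "moved s (x # v) = (if subst_letter s x = [x] then 0 else 1) + moved s v"
  by (simp_all add: moved_def)

lemma moved_replicate [simp]: "moved s (replicate k x) = k * moved s [x]"
  by (induction k) auto

lemma moved_subst_wd [simp]: "moved s (subst_wd s w) = moved s w"
proof (induction w)
  case (Cons x w)
  then show ?case by (cases s; cases x) (auto simp: subst_wd_Cons)
qed simp

lemma moved_subst_wd_pow [simp]: "moved s ((subst_wd s ^^ n) w) = moved s w"
  by (induction n) auto

lemma subst_wd_pow_append: "(subst_wd s ^^ n) (u @ v) = (subst_wd s ^^ n) u @ (subst_wd s ^^ n) v"
  by (induction n) (simp_all add: subst_wd_append)

lemma elt_subst_pow_cong:
  "elt u = elt v \<Longrightarrow> elt ((subst_wd s ^^ n) u) = elt ((subst_wd s ^^ n) v)"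
  by (induction n) (simp_all flip: gen_pi1_elt)

definition total_moved :: "mcg_gen \<Rightarrow> (int \<times> wd) list \<Rightarrow> nat" where
  "total_moved s ps = (\<Sum>(e, w)\<leftarrow>ps. moved s w)"

lemma total_moved_simps [simp]:
  "total_moved s [] = 0"
  "total_moved s ((e, w) # ps) = moved s w + total_moved s ps"
  "total_moved s (ps @ qs) = total_moved s ps + total_moved s qs"
  by (simp_all add: total_moved_def)

lemma total_moved_replicate [simp]: "total_moved s (replicate n (e, w)) = n * moved s w"
  by (induction n) auto

lemma total_moved_subst [simp]:
  "total_moved s (map_words (subst_wd s ^^ n) ps) = total_moved s ps"
  by (induction ps) auto

text \<open>The leading exponent is 0 so that \<open>q\<close> can follow an arbitrary power of
  \<open>z_elt\<close>. The other exponents are nonzero, so inserting a resolution creates no new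
  vanishing exponent.\<close>

definition resolution :: "pi1 \<Rightarrow> wd \<Rightarrow> (int \<times> wd) list \<Rightarrow> bool" where
  "resolution g q qs \<longleftrightarrow>
     g = zprod ((0, q) # qs) \<and> monotone_wd q \<and> monotone_form qs \<and> 0 \<notin> fst ` set qs"

lemma split_replicate:
  assumes "set w \<subseteq> {x, y}"
  shows "(\<exists>k. w = replicate k x) \<or> (\<exists>k v. w = replicate k x @ y # v)"
  using assms
proof (induction w)
  case (Cons c w)
  then consider k where "w = replicate k x" | k v where "w = replicate k x @ y # v"
    by auto
  then show ?case
  proof cases
    case 1
    with Cons.prems have "c # w = replicate (Suc k) x \<or> c # w = replicate 0 x @ y # w"
      by auto
    then show ?thesis by blast
  next
    case 2
    with Cons.prems have "c # w = replicate (Suc k) x @ y # v \<or> c # w = replicate 0 x @ y # w"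
      by auto
    then show ?thesis by blast
  qed
qed simp

lemma split_replicate_rev:
  assumes "set w \<subseteq> {x, y}"
  shows "(\<exists>k. w = replicate k x) \<or> (\<exists>k v. w = v @ y # replicate k x)"
proof -
  from split_replicate[of "rev w" x y] assms
  consider k where "rev w = replicate k x" | k v where "rev w = replicate k x @ y # v"
    by auto
  then show ?thesis
  proof cases
    case 1
    then have "w = replicate k x" by (metis rev_replicate rev_rev_ident)
    then show ?thesis by blast
  next
    case 2
    then have "w = rev v @ y # replicate k x"
      by (metis append.assoc append_Cons append_Nil rev.simps(2) rev_append rev_replicate
          rev_rev_ident)
    then show ?thesis by blast
  qed
qed

text \<open>
  The change from positive to negative letters (\<open>P = \<a>\<close>, \<open>Y = \<b>\<close>) is dealt with at once by
  \<open>t = \<L>\<close> and in the long run by \<open>s = \<R>\<close>.  For the change from negative to positive letters the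
  roles of the two generators are exchanged.
\<close>

locale turn =
  fixes P Y :: letter and s t :: mcg_gen and d :: int
  assumes turn_cases:
    "(P = \<a> \<and> Y = \<b> \<and> s = \<R> \<and> t = \<L> \<and> d = - 1) \<or> (P = \<B> \<and> Y = \<A> \<and> s = \<L> \<and> t = \<R> \<and> d = 1)"
begin

abbreviation "P' \<equiv> inv_letter P"
abbreviation "Y' \<equiv> inv_letter Y"

lemma subst_simps [simp]:
  "subst_letter s P = [P, Y]" "subst_letter s Y = [Y]"
  "subst_letter s P' = [Y', P']" "subst_letter s Y' = [Y']"
  "subst_letter t P = [P]" "subst_letter t Y = [P, Y]"
  "subst_letter t P' = [P']" "subst_letter t Y' = [Y', P']"
  using turn_cases by auto

lemma d_nonzero [simp]: "d \<noteq> 0"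
  using turn_cases by auto

lemma monotone_iff: "monotone_wd w \<longleftrightarrow> set w \<subseteq> {P, Y} \<or> set w \<subseteq> {P', Y'}"
  using turn_cases by (auto simp: monotone_wd_def)

lemma set_subst_pow:
  "set w \<subseteq> {P, Y} \<Longrightarrow> set ((subst_wd r ^^ n) w) \<subseteq> {P, Y}"
  "set w \<subseteq> {P', Y'} \<Longrightarrow> set ((subst_wd r ^^ n) w) \<subseteq> {P', Y'}"
  using turn_cases set_subst_wd_pow[where w = w and n = n and s = r]
  by (elim disjE; simp add: insert_commute)+

lemma set_subst:
  "set w \<subseteq> {P, Y} \<Longrightarrow> set (subst_wd r w) \<subseteq> {P, Y}"
  "set w \<subseteq> {P', Y'} \<Longrightarrow> set (subst_wd r w) \<subseteq> {P', Y'}"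
  using set_subst_pow[where n = 1 and r = r] by simp_all

text \<open>With \<open>z = \<a>\<B>\<A>\<b>\<close>, the four instances are
  \<open>\<a>\<b>\<A> = \<b>z\<^sup>-\<^sup>1\<close>, \<open>\<B>\<A>\<b> = \<A>z\<close>,
  \<open>\<a>\<B>\<A> = z\<B>\<close> and \<open>\<B>\<a>\<b> = z\<^sup>-\<^sup>1\<a>\<close>. The
  sign of the exponent is what \<open>d\<close> records.\<close>

lemma turn_elt:
  "elt [P, Y, P'] = elt [Y] \<otimes>\<^bsub>F2\<^esub> z_elt [^]\<^bsub>F2\<^esub> d"
  "elt [P, Y', P'] = z_elt [^]\<^bsub>F2\<^esub> (- d) \<otimes>\<^bsub>F2\<^esub> elt [Y']"
proof -
  have zi: "z_elt [^]\<^bsub>F2\<^esub> (- 1 :: int) = elt [\<B>, \<a>, \<b>, \<A>]"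
    using F2.int_pow_neg[of z_elt 1] by (simp add: inv_z_elt)
  note c = elt_cancel[of "[]" \<b> "[\<a>, \<b>, \<A>]"] elt_cancel[of "[]" \<A> "[\<B>, \<A>, \<b>]"]
    elt_cancel[of "[\<B>, \<a>, \<b>]" \<A> "[]"] elt_cancel[of "[\<a>, \<B>, \<A>]" \<b> "[]"]
  show "elt [P, Y, P'] = elt [Y] \<otimes>\<^bsub>F2\<^esub> z_elt [^]\<^bsub>F2\<^esub> d"
    using turn_cases c by (auto simp: zi mult_F2) (simp_all add: z_elt_def mult_F2)
  show "elt [P, Y', P'] = z_elt [^]\<^bsub>F2\<^esub> (- d) \<otimes>\<^bsub>F2\<^esub> elt [Y']"
    using turn_cases c by (auto simp: zi mult_F2) (simp_all add: z_elt_def mult_F2)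
qed

lemma turn_zprod:
  "elt (u @ P # Y # P' # v) = zprod [(0, u @ [Y]), (d, v)]"
  "elt (u @ P # Y' # P' # v) = zprod [(0, u), (- d, Y' # v)]"
proof -
  have "elt (u @ P # Y # P' # v) = elt u \<otimes>\<^bsub>F2\<^esub> (elt [P, Y, P'] \<otimes>\<^bsub>F2\<^esub> elt v)"
    by (simp add: mult_F2)
  then show "elt (u @ P # Y # P' # v) = zprod [(0, u @ [Y]), (d, v)]"
    by (simp add: turn_elt zprod_Cons zprod_Nil elt_append F2.m_assoc)
  have "elt (u @ P # Y' # P' # v) = elt u \<otimes>\<^bsub>F2\<^esub> (elt [P, Y', P'] \<otimes>\<^bsub>F2\<^esub> elt v)"
    by (simp add: mult_F2)
  then show "elt (u @ P # Y' # P' # v) = zprod [(0, u), (- d, Y' # v)]"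
    using elt_append[of "[Y']" v]
    by (simp add: turn_elt zprod_Cons zprod_Nil F2.m_assoc)
qed

text \<open>These are \<open>P Y\<^sup>k P' = (Y z\<^sup>d)\<^sup>k\<close> and \<open>P Y'\<^sup>k P' = (z\<^sup>-\<^sup>d Y')\<^sup>k\<close>, for \<open>k = Suc m\<close>.\<close>

lemma turn_zprod_pow:
  "elt (u @ P # replicate (Suc m) Y @ P' # v) =
     zprod ((0, u @ [Y]) # replicate m (d, [Y]) @ [(d, v)])"
  "elt (u @ P # replicate (Suc m) Y' @ P' # v) =
     zprod ((0, u) # replicate m (- d, [Y']) @ [(- d, Y' # v)])"
proof (induction m arbitrary: u)
  case 0
  case 1 show ?case by (simp add: turn_zprod)
  case 2 show ?case by (simp add: turn_zprod)
next
  case (Suc m)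
  let ?r = "P # replicate (Suc m) Y @ P' # v"
  let ?r' = "P # replicate (Suc m) Y' @ P' # v"
  case 1
  \<comment> \<open>Inserting \<open>P' P\<close> after the first \<open>Y\<close> splits off one
    block \<open>P Y P'\<close> and leaves a shorter block of the same shape.\<close>
  have "elt (u @ P # replicate (Suc (Suc m)) Y @ P' # v) = elt (u @ P # Y # P' # ?r)"
    using elt_cancel'[of "u @ [P, Y]" P "replicate (Suc m) Y @ P' # v"] by simp
  also have "\<dots> = zprod [(0, u @ [Y]), (d, ?r)]" by (rule turn_zprod)
  also have "\<dots> = zprod ((0, u @ [Y]) # (d, [Y]) # replicate m (d, [Y]) @ [(d, v)])"
    using Suc(1)[of "[]"] by (simp add: zprod_Cons zprod_Nil)
  finally show ?case by simp
  case 2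
  have "elt (u @ P # replicate (Suc (Suc m)) Y' @ P' # v) = elt (u @ P # Y' # P' # ?r')"
    using elt_cancel'[of "u @ [P, Y']" P "replicate (Suc m) Y' @ P' # v"] by simp
  also have "\<dots> = zprod [(0, u), (- d, Y' # ?r')]" by (rule turn_zprod)
  \<comment> \<open>Here \<open>Y'\<close> stands behind the power of \<open>z_elt\<close> and opens
    the next word, so the induction hypothesis is taken at \<open>[Y']\<close>.\<close>
  also have "\<dots> = zprod ((0, u) # (- d, [Y']) # replicate m (- d, [Y']) @ [(- d, Y' # v)])"
    using Suc(2)[of "[Y']"] by (simp add: zprod_Cons zprod_Nil)
  finally show ?case by simp
qed

text \<open>The letters at the junction either cancel, which shortens both words, or form
  \<open>P Y'\<close> or \<open>Y P'\<close>. In the latter case \<open>t\<close> produces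
  \<open>P Y' P'\<close> or \<open>P Y P'\<close>, and \<open>turn_zprod\<close> splits the word
  there, at the cost of a single new factor.\<close>

lemma resolve_fast:
  assumes "set u \<subseteq> {P, Y}" and "set v \<subseteq> {P', Y'}"
  shows "\<exists>q qs. resolution (elt (subst_wd t (u @ v))) q qs \<and> length qs \<le> 1 \<and>
     total_moved t ((0, q) # qs) \<le> moved t (u @ v)"
  using assms
proof (induction u arbitrary: v rule: rev_induct)
  case Nil
  then have "resolution (elt (subst_wd t v)) (subst_wd t v) []"
    using set_subst[of v] by (simp add: resolution_def zprod_Cons zprod_Nil monotone_iff)
  then show ?case by force
next
  case (snoc x u)
  show ?case
  proof (cases v)
    case Nil
    have "resolution (elt (subst_wd t (u @ [x]))) (subst_wd t (u @ [x])) []"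
      using set_subst(1)[of "u @ [x]" t] snoc.prems
      by (simp add: resolution_def zprod_Cons zprod_Nil monotone_iff)
    with Nil show ?thesis by (force simp del: moved_simps)
  next
    case (Cons y w)
    have mono: "set (subst_wd t u) \<subseteq> {P, Y}" "set (subst_wd t w) \<subseteq> {P', Y'}"
      using set_subst snoc.prems Cons by simp_all
    have "x = P \<or> x = Y" "y = P' \<or> y = Y'"
      using snoc.prems Cons by auto
    then consider "y = inv_letter x" | "x = P" "y = Y'" | "x = Y" "y = P'" by blast
    then show ?thesis
    proof cases
      case 1
      have "elt (subst_wd t (u @ [x] @ v)) = elt (subst_wd t (u @ w))"
        using elt_cancel[of u x w] by (simp add: Cons 1 flip: gen_pi1_elt)
      with snoc.IH[of w] snoc.prems Cons show ?thesis by fastforce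
    next
      case 2
      have "resolution (elt (subst_wd t (u @ [x] @ v))) (subst_wd t u) [(- d, Y' # subst_wd t w)]"
        using mono turn_zprod(2)[of "subst_wd t u" "subst_wd t w"]
        by (simp add: resolution_def Cons 2 subst_wd_append subst_wd_Cons monotone_iff)
      then show ?thesis
        by (intro exI conjI) (auto simp: Cons 2)
    next
      case 3
      have "resolution (elt (subst_wd t (u @ [x] @ v))) (subst_wd t u @ [Y]) [(d, subst_wd t w)]"
        using mono turn_zprod(1)[of "subst_wd t u" "subst_wd t w"]
        by (simp add: resolution_def Cons 3 subst_wd_append subst_wd_Cons monotone_iff)
      then show ?thesis
        by (intro exI conjI) (auto simp: Cons 3)
    qed
  qed
qed

section \<open>Iterates of \<open>s\<close>\<close>

lemma subst_replicate [simp]: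
  "subst_wd s (replicate n Y) = replicate n Y" "subst_wd s (replicate n Y') = replicate n Y'"
  by (induction n) (simp_all add: subst_wd_Cons)

lemma subst_pow_replicate [simp]:
  "(subst_wd s ^^ m) (replicate n Y) = replicate n Y"
  "(subst_wd s ^^ m) (replicate n Y') = replicate n Y'"
  by (induction m) simp_all

lemma subst_pow_P: "(subst_wd s ^^ n) [P] = P # replicate n Y"
  by (induction n) (simp_all add: subst_wd_Cons)

lemma subst_pow_P': "(subst_wd s ^^ n) [P'] = replicate n Y' @ [P']"
  by (induction n) (simp_all add: subst_wd_Cons subst_wd_append replicate_append_same)

lemma cancel_replicate:
  "elt (u @ replicate n Y @ replicate n Y' @ v) = elt (u @ v)"
proof (induction n arbitrary: u v)
  case (Suc n)
  have "elt (u @ replicate (Suc n) Y @ replicate (Suc n) Y' @ v) =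
      elt ((u @ replicate n Y) @ Y # Y' # replicate n Y' @ v)"
    by (simp add: replicate_app_Cons_same)
  also have "\<dots> = elt (u @ v)"
    unfolding elt_cancel using Suc by simp
  finally show ?case .
qed simp

text \<open>At a junction \<open>P Y'\<close>, if \<open>v\<close> is a power
  \<open>Y'\<^sup>k\<close>, then \<open>k\<close> steps of \<open>s\<close> turn \<open>P\<close>
  into \<open>P Y\<^sup>k\<close>, which absorbs \<open>v\<close>. Otherwise a block
  \<open>P Y'\<^sup>k P'\<close> occurs and is rewritten without applying \<open>s\<close>; this may
  create many factors but removes \<open>P\<close> and \<open>P'\<close>, hence the disjunction. The
  junction \<open>Y P'\<close> is the mirror image.\<close>

lemma resolve_slow:
  assumes "set u \<subseteq> {P, Y}" and "set v \<subseteq> {P', Y'}"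
  shows "\<exists>n q qs. resolution (elt ((subst_wd s ^^ n) (u @ v))) q qs \<and>
     (total_moved s ((0, q) # qs) < moved s (u @ v) \<or>
      total_moved s ((0, q) # qs) \<le> moved s (u @ v) \<and> length qs \<le> 1)"
  using assms
proof (induction u arbitrary: v rule: rev_induct)
  case Nil
  then have "resolution (elt ((subst_wd s ^^ 0) v)) v []"
    by (simp add: resolution_def zprod_Cons zprod_Nil monotone_iff)
  then show ?case by (intro exI[of _ 0] exI[of _ v] exI[of _ "[]"]) simp
next
  case (snoc x u)
  have u: "set u \<subseteq> {P, Y}" using snoc.prems by simp
  show ?case
  proof (cases v)
    case Nil
    have "resolution (elt ((subst_wd s ^^ 0) (u @ [x]))) (u @ [x]) []"
      using snoc.prems by (simp add: resolution_def zprod_Cons zprod_Nil monotone_iff)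
    with Nil show ?thesis by (intro exI[of _ 0] exI[of _ "u @ [x]"] exI[of _ "[]"]) simp
  next
    case (Cons y w)
    have w: "set w \<subseteq> {P', Y'}" using snoc.prems Cons by simp
    have "x = P \<or> x = Y" "y = P' \<or> y = Y'"
      using snoc.prems Cons by auto
    then consider "y = inv_letter x" | "x = P" "y = Y'" | "x = Y" "y = P'" by blast
    then show ?thesis
    proof cases
      case 1
      have "elt ((subst_wd s ^^ n) ((u @ [x]) @ v)) = elt ((subst_wd s ^^ n) (u @ w))" for n
        using elt_cancel[of u x w] by (intro elt_subst_pow_cong) (simp add: Cons 1)
      moreover obtain n q qs where "resolution (elt ((subst_wd s ^^ n) (u @ w))) q qs"
        "total_moved s ((0, q) # qs) < moved s (u @ w) \<or>
         total_moved s ((0, q) # qs) \<le> moved s (u @ w) \<and> length qs \<le> 1"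
        using snoc.IH[OF u w] by blast
      moreover have "moved s (u @ w) \<le> moved s ((u @ [x]) @ v)" by (simp add: Cons)
      ultimately show ?thesis
        by (intro exI[of _ n] exI[of _ q] exI[of _ qs]) auto
    next
      case 2
      from split_replicate[of v Y' P'] snoc.prems(2)
      consider k where "v = replicate k Y'" | k v' where "v = replicate k Y' @ P' # v'"
        by auto
      then show ?thesis
      proof cases
        case (1 k)
        define q where "q = (subst_wd s ^^ k) u @ [P]"
        have "elt ((subst_wd s ^^ k) ((u @ [x]) @ v)) = elt q"
          using cancel_replicate[of "(subst_wd s ^^ k) u @ [P]" k "[]"]
          unfolding subst_wd_pow_append 1 2 q_def subst_pow_P by simp
        moreover have "set q \<subseteq> {P, Y}"
          using set_subst_pow(1)[OF u] by (simp add: q_def)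
        ultimately have "resolution (elt ((subst_wd s ^^ k) ((u @ [x]) @ v))) q []"
          by (simp add: resolution_def zprod_Cons zprod_Nil monotone_iff)
        then show ?thesis
          by (intro exI[of _ k] exI[of _ q] exI[of _ "[]"]) (simp add: q_def 2)
      next
        case (2 k v')
        \<comment> \<open>\<open>k\<close> is positive because \<open>v\<close> begins with
          \<open>Y'\<close>, which differs from \<open>P'\<close>.\<close>
        with Cons \<open>y = Y'\<close> turn_cases obtain m where k: "k = Suc m"
          by (cases k) auto
        let ?qs = "replicate m (- d, [Y']) @ [(- d, Y' # v')]"
        have "set v' \<subseteq> {P', Y'}" using snoc.prems(2) by (simp add: 2)
        then have "resolution (elt ((subst_wd s ^^ 0) ((u @ [x]) @ v))) u ?qs"
          using u turn_zprod_pow(2)[of u m v'] \<open>x = P\<close>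
          by (auto simp: resolution_def 2 k monotone_iff monotone_form_def)
        moreover have "total_moved s ((0, u) # ?qs) < moved s ((u @ [x]) @ v)"
          by (simp add: 2 k \<open>x = P\<close>)
        ultimately show ?thesis by blast
      qed
    next
      case 3
      from split_replicate_rev[of "u @ [x]" Y P] snoc.prems(1)
      consider k where "u @ [x] = replicate k Y" | k u' where "u @ [x] = u' @ P # replicate k Y"
        by auto
      then show ?thesis
      proof cases
        case (1 k)
        define q where "q = P' # (subst_wd s ^^ k) w"
        have "(subst_wd s ^^ k) v = replicate k Y' @ q"
          using subst_wd_pow_append[where u = "[P']" and v = w]
          by (simp add: Cons 3 q_def subst_pow_P')
        then have "elt ((subst_wd s ^^ k) ((u @ [x]) @ v)) = elt q"
          using cancel_replicate[of "[]" k q]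
          unfolding 1 subst_wd_pow_append[of _ _ "replicate k Y"] by simp
        moreover have "set q \<subseteq> {P', Y'}"
          using set_subst_pow(2)[OF w] by (simp add: q_def)
        ultimately have "resolution (elt ((subst_wd s ^^ k) ((u @ [x]) @ v))) q []"
          by (simp add: resolution_def zprod_Cons zprod_Nil monotone_iff)
        then show ?thesis
          by (intro exI[of _ k] exI[of _ q] exI[of _ "[]"]) (simp add: q_def 3 Cons)
      next
        case (2 k u')
        with \<open>x = Y\<close> have "last (P # replicate k Y) = Y"
          by (metis last_appendR last_snoc list.discI)
        moreover have "P \<noteq> Y" using turn_cases by auto
        ultimately obtain m where k: "k = Suc m"
          by (cases k) auto
        let ?qs = "replicate m (d, [Y]) @ [(d, w)]"
        have "set u' \<subseteq> {P, Y}"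
          using snoc.prems(1) unfolding 2 by simp
        then have "resolution (elt ((subst_wd s ^^ 0) ((u @ [x]) @ v))) (u' @ [Y]) ?qs"
          using w turn_zprod_pow(1)[of u' m w] \<open>y = P'\<close>
          unfolding 2 by (auto simp: resolution_def Cons k monotone_iff monotone_form_def)
        moreover have "total_moved s ((0, u' @ [Y]) # ?qs) < moved s ((u @ [x]) @ v)"
          unfolding 2 by (simp add: k Cons \<open>y = P'\<close>)
        ultimately show ?thesis by blast
      qed
    qed
  qed
qed

end

lemma turn_positive: "turn \<a> \<b> \<R> \<L> (- 1)" and turn_negative: "turn \<B> \<A> \<L> \<R> 1"
  by unfold_locales simp_all

lemma monotone_append_or_turn:
  assumes "monotone_wd u" and "monotone_wd v"
  obtains "monotone_wd (u @ v)"
  | P Y s t d where "turn P Y s t d" "set u \<subseteq> {P, Y}" "set v \<subseteq> {inv_letter P, inv_letter Y}"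
proof -
  consider "monotone_wd (u @ v)" | "set u \<subseteq> {\<a>, \<b>}" "set v \<subseteq> {\<A>, \<B>}"
    | "set u \<subseteq> {\<B>, \<A>}" "set v \<subseteq> {\<b>, \<a>}"
    using assms unfolding monotone_wd_def by auto
  then show ?thesis
  proof cases
    case 2
    with turn_positive show ?thesis by (intro that(2)) auto
  next
    case 3
    with turn_negative show ?thesis by (intro that(2)) auto
  qed (rule that(1))
qed

text \<open>A given generator plays the part of \<open>s\<close> for one kind of sign change and of
  \<open>t\<close> for the other, so iterating it meets both the slow and the fast
  resolution.\<close>

lemma resolve_pow:
  assumes "monotone_wd u" and "monotone_wd v"
  shows "\<exists>n q qs. resolution (elt ((subst_wd r ^^ n) (u @ v))) q qs \<and>
     (total_moved r ((0, q) # qs) < moved r (u @ v) \<or>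
      total_moved r ((0, q) # qs) \<le> moved r (u @ v) \<and> length qs \<le> 1)"
  using assms
proof (cases rule: monotone_append_or_turn)
  case 1
  then have "resolution (elt ((subst_wd r ^^ 0) (u @ v))) (u @ v) []"
    by (simp add: resolution_def zprod_Cons zprod_Nil)
  then show ?thesis by (intro exI[of _ 0] exI[of _ "u @ v"] exI[of _ "[]"]) simp
next
  case (2 P Y s t d)
  then interpret turn P Y s t d by simp
  have "r = s \<or> r = t" using turn_cases by (cases r) auto
  then show ?thesis
  proof
    assume "r = s"
    with resolve_slow[OF 2(2,3)] show ?thesis by simp
  next
    assume "r = t"
    moreover obtain q qs where "resolution (elt (subst_wd t (u @ v))) q qs \<and> length qs \<le> 1 \<and>
        total_moved t ((0, q) # qs) \<le> moved t (u @ v)"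
      using resolve_fast[OF 2(2,3)] by blast
    ultimately show ?thesis
      by (intro exI[of _ 1] exI[of _ q] exI[of _ qs]) simp
  qed
qed


section \<open>Finiteness of the unstable part of the tree\<close>

definition zeros :: "(int \<times> wd) list \<Rightarrow> nat" where
  "zeros ps = length (filter (\<lambda>(e, w). e = 0) ps)"

lemma zeros_simps [simp]:
  "zeros [] = 0"
  "zeros ((e, w) # ps) = (if e = 0 then 1 else 0) + zeros ps"
  "zeros (ps @ qs) = zeros ps + zeros qs"
  by (simp_all add: zeros_def)

lemma zeros_map_words [simp]: "zeros (map_words f ps) = zeros ps"
  by (induction ps) auto

lemma zeros_eq_0: "0 \<notin> fst ` set ps \<Longrightarrow> zeros ps = 0"
  by (induction ps) auto

lemma zprod_merge_Nil: "zprod ((e, []) # (f, v) # ps) = zprod ((e + f, v) # ps)"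
  by (simp add: zprod_Cons F2.int_pow_mult F2.m_assoc flip: one_F2)

lemma zprod_merge_0: "zprod ((e, u) # (0, v) # ps) = zprod ((e, u @ v) # ps)"
  by (simp add: zprod_Cons elt_append F2.m_assoc)

lemma resolution_step:
  assumes "resolution (elt ((subst_wd s ^^ n) (u @ v))) q qs"
  shows "curve_of (zprod ((e, q) # qs @ map_words (subst_wd s ^^ n) ps)) =
    (gen_curve s ^^ n) (curve_of (zprod ((e, u) # (0, v) # ps)))"
proof -
  let ?ps = "map_words (subst_wd s ^^ n) ps"
  have "zprod ((e, q) # qs @ ?ps) = z_elt [^]\<^bsub>F2\<^esub> e \<otimes>\<^bsub>F2\<^esub> (zprod ((0, q) # qs) \<otimes>\<^bsub>F2\<^esub> zprod ?ps)"
    by (simp add: zprod_Cons zprod_append F2.m_assoc)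
  also have "\<dots> = zprod (map_words (subst_wd s ^^ n) ((e, u @ v) # ps))"
    using assms by (simp add: resolution_def zprod_Cons)
  finally show ?thesis
    by (simp only: zprod_merge_0 gen_curve_pow_zprod)
qed

text \<open>A single factor is either stable or a power of \<open>z_elt\<close>, so there are at
  least two, one of them defective. Rotation places an empty word first, to merge with its
  successor, or a vanishing exponent second, to merge with its predecessor.\<close>

lemma unstable_cases:
  assumes "essential (curve_of (zprod ps))" and "\<not> stable (curve_of (zprod ps))"
    and "monotone_form ps"
  obtains e u f v rest where "curve_of (zprod ((e, u) # (f, v) # rest)) = curve_of (zprod ps)"
    "mset ((e, u) # (f, v) # rest) = mset ps" "u = [] \<or> f = 0"
proof -
  have "length ps \<ge> 1"
  proof (rule ccontr)
    assume "\<not> length ps \<ge> 1"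
    then have "zprod ps = z_elt [^]\<^bsub>F2\<^esub> (0::int)" by (simp add: zprod_Nil Suc_le_eq)
    with assms(1) show False unfolding essential_iff by metis
  qed
  have l: "length ps \<ge> 2"
  proof (rule ccontr)
    assume "\<not> length ps \<ge> 2"
    with \<open>length ps \<ge> 1\<close> obtain e w where ps: "ps = [(e, w)]"
      by (cases ps) (auto simp: Suc_le_eq)
    show False
    proof (cases "w = []")
      case True
      then have "zprod ps = z_elt [^]\<^bsub>F2\<^esub> e" by (simp add: ps zprod_Cons zprod_Nil flip: one_F2)
      with assms(1) show False unfolding essential_iff by metis
    next
      case False
      with assms(2,3) ps show False unfolding stable_def by fastforce
    qed
  qed
  obtain e w where ew: "(e, w) \<in> set ps" "e = 0 \<or> w = []"
    using assms(2,3) \<open>length ps \<ge> 1\<close> unfolding stable_def monotone_form_def by blast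
  then obtain xs ys where ps: "ps = xs @ (e, w) # ys" by (meson split_list)
  with l have ne: "ys @ xs \<noteq> []" by auto
  show ?thesis
  proof (cases "w = []")
    case True
    from ne obtain f v rest where r: "ys @ xs = (f, v) # rest"
      by (metis list.exhaust surj_pair)
    have "curve_of (zprod ((e, w) # (f, v) # rest)) = curve_of (zprod ps)"
      using curve_of_rotate[of xs "(e, w) # ys"] by (simp add: ps flip: r)
    moreover have "mset ((e, w) # (f, v) # rest) = mset ps"
      using arg_cong[OF r, of mset] by (simp add: ps union_commute)
    ultimately show ?thesis using True that by blast
  next
    case False
    with ew have "e = 0" by simp
    from ne obtain f v rest where r: "ys @ xs = rest @ [(f, v)]"
      by (metis rev_exhaust surj_pair)
    have "curve_of (zprod ((f, v) # (e, w) # rest)) = curve_of (zprod (((e, w) # ys) @ xs))"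
      using curve_of_rotate[of "[(f, v)]" "(e, w) # rest"] by (simp add: r)
    also have "\<dots> = curve_of (zprod ps)"
      using curve_of_rotate[of xs "(e, w) # ys"] by (simp add: ps)
    finally have "curve_of (zprod ((f, v) # (e, w) # rest)) = curve_of (zprod ps)" .
    moreover have "mset ((f, v) # (e, w) # rest) = mset ps"
      using arg_cong[OF r, of mset] by (simp add: ps union_commute)
    ultimately show ?thesis using \<open>e = 0\<close> that by blast
  qed
qed

text \<open>Makes the measures of the inductions insensitive to the rotation in
  \<open>unstable_cases\<close>.\<close>

lemma mset_eq_invariants:
  assumes "mset ps = mset qs"
  shows "length ps = length qs" and "zeros ps = zeros qs"
    and "total_moved s ps = total_moved s qs" and "monotone_form ps = monotone_form qs"
proof -
  show "length ps = length qs" using assms by (rule mset_eq_length)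
  show "zeros ps = zeros qs"
    using assms unfolding zeros_def by (metis mset_filter size_mset)
  show "total_moved s ps = total_moved s qs"
    using assms unfolding total_moved_def by (metis mset_map sum_mset_sum_list)
  show "monotone_form ps = monotone_form qs"
    using mset_eq_setD[OF assms] unfolding monotone_form_def by simp
qed

text \<open>\<open>total_moved s\<close> has to come first in the measure, since a slow resolution
  can lengthen the form when it lowers this number.\<close>

lemma stable_pow:
  assumes "essential (curve_of (zprod ps))" and "monotone_form ps"
  shows "\<exists>N. stable ((gen_curve s ^^ N) (curve_of (zprod ps)))"
  using assms
proof (induction ps rule: wf_induct_rule[OF wf_measures[of "[total_moved s, length, zeros]"]])
  case (1 ps)
  show ?case
  proof (cases "stable (curve_of (zprod ps))")
    case True
    then have "stable ((gen_curve s ^^ 0) (curve_of (zprod ps)))" by simp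
    then show ?thesis by blast
  next
    case False
    from unstable_cases[OF 1(2) False 1(3)] obtain e u f v rest where
      c: "curve_of (zprod ((e, u) # (f, v) # rest)) = curve_of (zprod ps)" and
      m: "mset ((e, u) # (f, v) # rest) = mset ps" and uf: "u = [] \<or> f = 0" .
    note inv = mset_eq_invariants[OF m, symmetric]
    have mono: "monotone_wd u" "monotone_wd v" "monotone_form rest"
      using 1(3) by (simp_all add: inv)
    show ?thesis
    proof (cases "u = []")
      case True
      let ?qs = "(e + f, v) # rest"
      have cq: "curve_of (zprod ?qs) = curve_of (zprod ps)"
        using c by (simp add: True zprod_merge_Nil)
      have "(?qs, ps) \<in> measures [total_moved s, length, zeros]"
        by (simp add: inv True)
      from 1(1)[OF this] show ?thesis using 1(2) mono by (simp add: cq)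
    next
      case False
      with uf have f: "f = 0" by simp
      obtain n q qs where r: "resolution (elt ((subst_wd s ^^ n) (u @ v))) q qs"
        and b: "total_moved s ((0, q) # qs) < moved s (u @ v) \<or>
          total_moved s ((0, q) # qs) \<le> moved s (u @ v) \<and> length qs \<le> 1"
        using resolve_pow[OF mono(1,2)] by blast
      let ?qs = "(e, q) # qs @ map_words (subst_wd s ^^ n) rest"
      have cq: "curve_of (zprod ?qs) = (gen_curve s ^^ n) (curve_of (zprod ps))"
        using resolution_step[OF r] c f by simp
      have "zeros qs = 0" "monotone_form ?qs"
        using r mono(3) by (simp_all add: resolution_def zeros_eq_0 monotone_form_subst)
      \<comment> \<open>If \<open>total_moved s\<close> does not drop, then either \<open>qs\<close>
        is empty and the form gets shorter, or its one factor replaces \<open>(0, v)\<close> by a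
        factor with nonzero exponent.\<close>
      moreover have "(?qs, ps) \<in> measures [total_moved s, length, zeros]"
        using b \<open>zeros qs = 0\<close> by (auto simp: inv f le_Suc_eq)
      ultimately obtain N where "stable ((gen_curve s ^^ N) (curve_of (zprod ?qs)))"
        using 1(1)[of ?qs] 1(2) essential_gen_curve_pow unfolding cq by blast
      then have "stable ((gen_curve s ^^ (N + n)) (curve_of (zprod ps)))"
        unfolding cq by (simp add: funpow_add)
      then show ?thesis by blast
    qed
  qed
qed

section \<open>Splitting the tree along the powers of one generator\<close>

lemma pos_act_append: "pos_act (M @ N) \<gamma> = pos_act M (pos_act N \<gamma>)"
  by (simp add: pos_act_def)

lemma pos_act_replicate: "pos_act (replicate n s) \<gamma> = (gen_curve s ^^ n) \<gamma>"
  by (induction n) (simp_all add: pos_act_def)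

lemma mcg_word_split:
  fixes s t :: mcg_gen
  assumes "s \<noteq> t"
  shows "(\<exists>j. M = replicate j s) \<or> (\<exists>j M'. M = M' @ t # replicate j s)"
proof (induction M rule: rev_induct)
  case Nil
  have "[] = replicate 0 s" by simp
  then show ?case by blast
next
  case (snoc r M)
  have "r = s \<or> r = t"
    by (cases r; cases s; cases t) (use assms in simp_all)
  with snoc.IH consider j where "r = s" "M = replicate j s"
    | j M' where "r = s" "M = M' @ t # replicate j s" | "r = t" by blast
  then show ?case
  proof cases
    case 1
    then have "M @ [r] = replicate (Suc j) s" by (simp add: replicate_append_same)
    then show ?thesis by blast
  next
    case 2
    then have "M @ [r] = M' @ t # replicate (Suc j) s" by (simp add: replicate_append_same)
    then show ?thesis by blast
  next
    case 3
    then have "M @ [r] = M @ t # replicate 0 s" by simp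
    then show ?thesis by blast
  qed
qed

text \<open>The final block \<open>s\<^sup>j\<close> of a word acts first. As stability is
  inherited, an unstable vertex has \<open>j < N\<close>, and each such \<open>j\<close> contributes
  \<open>s\<^sup>j\<close> itself and finitely many words ending in
  \<open>t s\<^sup>j\<close>.\<close>

lemma finite_unstable_split:
  assumes "s \<noteq> t" and "stable ((gen_curve s ^^ N) \<gamma>)"
    and "\<And>j. finite {M. \<not> stable (pos_act M (gen_curve t ((gen_curve s ^^ j) \<gamma>)))}"
  shows "finite {M. \<not> stable (pos_act M \<gamma>)}"
proof (rule finite_subset)
  let ?U = "\<lambda>\<gamma>. {M. \<not> stable (pos_act M \<gamma>)}"
  let ?B = "(\<lambda>j. replicate j s) ` {..<N} \<union>
    (\<Union>j<N. (\<lambda>M. M @ t # replicate j s) ` ?U (gen_curve t ((gen_curve s ^^ j) \<gamma>)))"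
  show "finite ?B" using assms(3) by simp
  have st: "stable ((gen_curve s ^^ j) \<gamma>)" if "j \<ge> N" for j
  proof -
    have "(gen_curve s ^^ j) \<gamma> = pos_act (replicate (j - N) s) ((gen_curve s ^^ N) \<gamma>)"
      using that by (simp add: pos_act_replicate flip: comp_apply[of "gen_curve s ^^ _"] funpow_add)
    then show ?thesis using stable_pos_act[OF assms(2)] by simp
  qed
  show "?U \<gamma> \<subseteq> ?B"
  proof
    fix M assume M: "M \<in> ?U \<gamma>"
    from mcg_word_split[OF assms(1)]
    consider j where "M = replicate j s" | j M' where "M = M' @ t # replicate j s" by blast
    then show "M \<in> ?B"
    proof cases
      case 1
      with M st[of j] have "j < N" by (simp add: pos_act_replicate) (metis linorder_not_le)
      with 1 show ?thesis by blast
    next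
      case 2
      have eq: "pos_act M \<gamma> = pos_act M' (gen_curve t ((gen_curve s ^^ j) \<gamma>))"
        by (simp add: 2 pos_act_append flip: pos_act_replicate) (simp add: pos_act_def)
      with M st stable_gen_curve stable_pos_act have "j < N" by (metis linorder_not_le mem_Collect_eq)
      with 2 M eq show ?thesis by auto
    qed
  qed
qed

text \<open>Each branch \<open>t s\<^sup>j\<close> ends with a fast resolution, which adds at most
  one factor, so \<open>length\<close> and \<open>zeros\<close> suffice as measure. The number of
  branches to consider is bounded through \<open>stable_pow\<close>.\<close>

lemma finite_unstable:
  assumes "essential (curve_of (zprod ps))" and "monotone_form ps"
  shows "finite {M. \<not> stable (pos_act M (curve_of (zprod ps)))}"
  using assms
proof (induction ps rule: wf_induct_rule[OF wf_measures[of "[length, zeros]"]])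
  case (1 ps)
  let ?\<gamma> = "curve_of (zprod ps)"
  show ?case
  proof (cases "stable ?\<gamma>")
    case True
    then show ?thesis by (simp add: stable_pos_act)
  next
    case False
    from unstable_cases[OF 1(2) False 1(3)] obtain e u f v rest where
      c: "curve_of (zprod ((e, u) # (f, v) # rest)) = ?\<gamma>" and
      m: "mset ((e, u) # (f, v) # rest) = mset ps" and uf: "u = [] \<or> f = 0" .
    note inv = mset_eq_invariants[OF m, symmetric]
    have mono: "monotone_wd u" "monotone_wd v" "monotone_form rest"
      using 1(3) by (simp_all add: inv)
    show ?thesis
    proof (cases "u = []")
      case True
      let ?qs = "(e + f, v) # rest"
      have cq: "curve_of (zprod ?qs) = ?\<gamma>"
        using c by (simp add: True zprod_merge_Nil)
      have "(?qs, ps) \<in> measures [length, zeros]" by (simp add: inv)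
      from 1(1)[OF this] show ?thesis using 1(2) mono by (simp add: cq)
    next
      case False
      with uf have f: "f = 0" by simp
      from mono(1,2) show ?thesis
      proof (cases rule: monotone_append_or_turn)
        case 1
        let ?qs = "(e, u @ v) # rest"
        have cq: "curve_of (zprod ?qs) = ?\<gamma>"
          using c by (simp add: f zprod_merge_0)
        have "(?qs, ps) \<in> measures [length, zeros]" by (simp add: inv)
        from "1.IH"[OF this] show ?thesis using "1.prems" mono 1 by (simp add: cq)
      next
        case (2 P Y s t d)
        then interpret turn P Y s t d by simp
        have "s \<noteq> t" using turn_cases by auto
        obtain N where N: "stable ((gen_curve s ^^ N) ?\<gamma>)"
          using stable_pow[OF "1.prems"] by blast
        \<comment> \<open>The powers of \<open>s\<close> keep the signs of \<open>u\<close> and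
          \<open>v\<close>, so the sign change persists and \<open>resolve_fast\<close> applies for
          every \<open>j\<close>.\<close>
        have "finite {M. \<not> stable (pos_act M (gen_curve t ((gen_curve s ^^ j) ?\<gamma>)))}" for j
        proof -
          let ?u = "(subst_wd s ^^ j) u" and ?v = "(subst_wd s ^^ j) v"
          let ?rest = "map_words (subst_wd s ^^ j) rest"
          have cj: "curve_of (zprod ((e, ?u) # (0, ?v) # ?rest)) = (gen_curve s ^^ j) ?\<gamma>"
            by (simp add: f gen_curve_pow_zprod flip: c)
          obtain q qs where r: "resolution (elt (subst_wd t (?u @ ?v))) q qs" "length qs \<le> 1"
            using resolve_fast[OF set_subst_pow(1)[OF 2(2)] set_subst_pow(2)[OF 2(3)]] by blast
          let ?qs = "(e, q) # qs @ map_words (subst_wd t ^^ 1) ?rest"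
          have cq: "curve_of (zprod ?qs) = gen_curve t ((gen_curve s ^^ j) ?\<gamma>)"
            using resolution_step[where s = t and n = 1 and q = q and qs = qs and e = e and ps = ?rest and u = ?u and v = ?v] r(1) cj by simp
          have "zeros qs = 0" "monotone_form ?qs"
            using r(1) mono(3) monotone_form_subst[where n = 1]
            by (simp_all add: resolution_def zeros_eq_0 monotone_form_subst)
          moreover have "(?qs, ps) \<in> measures [length, zeros]"
            using r(2) \<open>zeros qs = 0\<close> by (auto simp: inv f le_Suc_eq)
          ultimately show ?thesis
            using "1.IH"[of ?qs] "1.prems"(1) essential_gen_curve essential_gen_curve_pow
            unfolding cq by blast
        qed
        with \<open>s \<noteq> t\<close> N show ?thesis by (rule finite_unstable_split)
      qed
    qed
  qed
qed

theorem proposition1p5: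
  fixes \<gamma> :: curve
  assumes "essential \<gamma>"
  shows "finite {M :: mcg_gen list. \<not> stable (tree_label \<gamma> M)}"
proof -
  obtain g where g: "\<gamma> = curve_of g" by (metis Quotient_curve Quotient_abs_rep)
  obtain w where w: "g = elt w" by (rule elt_cases)
  let ?ps = "map (\<lambda>x. (0, [x])) w :: (int \<times> wd) list"
  have "monotone_wd [x]" for x by (cases x) (auto simp: monotone_wd_def)
  then have "monotone_form ?ps" by (auto simp: monotone_form_def)
  moreover have "\<gamma> = curve_of (zprod ?ps)" by (simp add: g w zprod_letters)
  ultimately show ?thesis
    using finite_unstable[of ?ps] assms by (simp add: tree_label_def)
qed

end
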